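(* Let $q \ge 0$ be an integer, let $\omega$ be an open subset of $\mathbb{R}^n$, and let $\Omega = \omega + i\mathbb{R}^n \subset \mathbb{C}^n$. Let $\psi:\Omega\to[-\infty,+\infty)$ be an upper semi-continuous function such that $\psi(z)=\psi(\operatorname{Re}(z))$ for every $z\in\Omega$. Then $\psi$ is $q$-plurisubharmonic on $\Omega$ if and only if the function $x\mapsto\psi(x)$ is real $q$-convex on $\omega$.
   Context: Real $q$-convex functions: let $\omega\subset\mathbb{R}^n$ be open and $q\in\{0,\dots,n-1\}$. An upper semi-continuous function $u:\omega\to[-\infty,+\infty)$ is real $q$-convex on $\omega$ if for every real $(q+1)$-dimensional affine subspace $\pi$ of $\mathbb{R}^n$, every open Euclidean ball $B$ relatively compact in $\omega$ and every affine linear function $l:\pi\to\mathbb{R}$ with $u\le l$ on $\partial B\cap\pi$, one has $u\le l$ on $\overline{B}\cap\pi$. If $q\ge n$, every upper semi-continuous function on $\omega$ is real $q$-convex by convention. $q$-plurisubharmonic functions: let $\Omega\subset\mathbb{C}^n$ be open and $q\in\{0,\dots,n-1\}$. An upper semi-continuous function $\psi:\Omega\to[-\infty,+\infty)$ is $q$-plurisubharmonic on $\Omega$ if for every complex $(q+1)$-dimensional affine subspace $\Pi$ of $\mathbb{C}^n$, every open Euclidean ball $B$ relatively compact in $\Omega$ and every pluriharmonic function $h$ defined in a neighborhood of $\overline{B}$ with $\psi\le h$ on $\partial B\cap\Pi$, one has $\psi\le h$ on $\overline{B}\cap\Pi$. If $q\ge n$, every upper semi-continuous function on $\Omega$ is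 $q$-plurisubharmonic by convention. *)

theory Defs
  imports "HOL-Analysis.Analysis"
begin

text \<open>
  Functions with values in \<open>[-\<infinity>, +\<infinity>)\<close> on a set \<open>S\<close> are rendered as total functions into
  \<^typ>\<open>ereal\<close> that do not take the value \<open>\<infinity>\<close> on \<open>S\<close>; values outside \<open>S\<close> are irrelevant.
\<close>

definition usc_on :: "'a::topological_space set \<Rightarrow> ('a \<Rightarrow> ereal) \<Rightarrow> bool" where
  "usc_on S u \<longleftrightarrow>
     (\<forall>x\<in>S. u x < \<infinity>) \<and> (\<forall>x\<in>S. \<forall>c. u x < c \<longrightarrow> (\<forall>\<^sub>F y in at x within S. u y < c))"


subsection \<open>Real q-convex functions\<close>

definition affine_fun_on :: "'a::real_vector set \<Rightarrow> ('a \<Rightarrow> real) \<Rightarrow> bool" where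
  "affine_fun_on \<pi> l \<longleftrightarrow>
     (\<forall>x\<in>\<pi>. \<forall>y\<in>\<pi>. \<forall>t. l ((1 - t) *\<^sub>R x + t *\<^sub>R y) = (1 - t) * l x + t * l y)"

definition real_q_convex_on :: "nat \<Rightarrow> (real^'n) set \<Rightarrow> (real^'n \<Rightarrow> ereal) \<Rightarrow> bool" where
  "real_q_convex_on q \<omega> u \<longleftrightarrow>
     usc_on \<omega> u \<and>
     (q < CARD('n) \<longrightarrow>
       (\<forall>\<pi> a r l.
          affine \<pi> \<and> aff_dim \<pi> = int (q + 1) \<and>
          0 < r \<and> cball a r \<subseteq> \<omega> \<and>
          affine_fun_on \<pi> l \<and>
          (\<forall>x \<in> sphere a r \<inter> \<pi>. u x \<le> ereal (l x))
          \<longrightarrow> (\<forall>x \<in> cball a r \<inter> \<pi>. u x \<le> ereal (l x))))"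


subsection \<open>Pluriharmonic functions\<close>

definition C2_derivs_on ::
  "'a::real_normed_vector set \<Rightarrow> ('a \<Rightarrow> real) \<Rightarrow>
     ('a \<Rightarrow> 'a \<Rightarrow>\<^sub>L real) \<Rightarrow> ('a \<Rightarrow> 'a \<Rightarrow>\<^sub>L 'a \<Rightarrow>\<^sub>L real) \<Rightarrow> bool" where
  "C2_derivs_on U f f' f'' \<longleftrightarrow>
     open U \<and>
     (\<forall>x\<in>U. (f has_derivative blinfun_apply (f' x)) (at x)) \<and>
     (\<forall>x\<in>U. (f' has_derivative blinfun_apply (f'' x)) (at x)) \<and>
     continuous_on U f''"

text \<open>
  With \<open>\<zeta> = x + i y\<close>, the Laplacian \<open>h\<^sub>x\<^sub>x + h\<^sub>y\<^sub>y\<close> is the sum of the second derivatives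
  in the directions \<open>1\<close> and \<open>i\<close>.
\<close>

definition harmonic_on :: "complex set \<Rightarrow> (complex \<Rightarrow> real) \<Rightarrow> bool" where
  "harmonic_on U h \<longleftrightarrow>
     (\<exists>h' h''. C2_derivs_on U h h' h'' \<and>
        (\<forall>\<zeta>\<in>U. blinfun_apply (blinfun_apply (h'' \<zeta>) 1) 1
              + blinfun_apply (blinfun_apply (h'' \<zeta>) \<i>) \<i> = 0))"

definition pluriharmonic_on :: "(complex^'n) set \<Rightarrow> (complex^'n \<Rightarrow> real) \<Rightarrow> bool" where
  "pluriharmonic_on U h \<longleftrightarrow>
     (\<exists>h' h''. C2_derivs_on U h h' h'') \<and>
     (\<forall>a b. harmonic_on {\<zeta>. a + \<zeta> *s b \<in> U} (\<lambda>\<zeta>. h (a + \<zeta> *s b)))"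


subsection \<open>q-plurisubharmonic functions\<close>

text \<open>
  The library notions \<^const>\<open>affine\<close> and \<^const>\<open>aff_dim\<close> are real; complex affine subspaces
  are translates of subspaces with respect to the complex scalar multiplication \<open>*s\<close>.
\<close>

definition complex_affine_subspace :: "nat \<Rightarrow> (complex^'n) set \<Rightarrow> bool" where
  "complex_affine_subspace d P \<longleftrightarrow>
     (\<exists>p L. vec.subspace L \<and> vec.dim L = d \<and> P = (+) p ` L)"

definition q_psh_on :: "nat \<Rightarrow> (complex^'n) set \<Rightarrow> (complex^'n \<Rightarrow> ereal) \<Rightarrow> bool" where
  "q_psh_on q \<Omega> \<psi> \<longleftrightarrow>
     usc_on \<Omega> \<psi> \<and>
     (q < CARD('n) \<longrightarrow>
       (\<forall>P a r U h.
          complex_affine_subspace (q + 1) P \<and>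
          0 < r \<and> cball a r \<subseteq> \<Omega> \<and>
          cball a r \<subseteq> U \<and> pluriharmonic_on U h \<and>
          (\<forall>z \<in> sphere a r \<inter> P. \<psi> z \<le> ereal (h z))
          \<longrightarrow> (\<forall>z \<in> cball a r \<inter> P. \<psi> z \<le> ereal (h z))))"


subsection \<open>Tube domains\<close>

definition cvec :: "real^'n \<Rightarrow> complex^'n" where
  "cvec x = (\<chi> i. complex_of_real (x $ i))"

definition Re_vec :: "complex^'n \<Rightarrow> real^'n" where
  "Re_vec z = (\<chi> i. Re (z $ i))"

definition tube :: "(real^'n) set \<Rightarrow> (complex^'n) set" where
  "tube \<omega> = {cvec x + \<i> *s cvec y | x y. x \<in> \<omega>}"

end

theory Submission
  imports Defs
begin

text \<open>
  Both implications are local arguments at a point where the function is strictly touched from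
  above, and both rest on \<open>Re (\<Sum>\<^sub>j w\<^sub>j\<^sup>2) = |Re w|\<^sup>2 - |Im w|\<^sup>2\<close> being pluriharmonic or, more generally, on
  \<open>D (i w) (i w) = - D w w\<close> for the Hessian \<open>D\<close> of a pluriharmonic function.

  If real \<open>q\<close>-convexity fails, then near some \<open>x\<^sub>0\<close> in \<open>\<pi>\<close> one has
  \<open>\<psi> x \<le> A x - \<epsilon> |x - x\<^sub>0|\<^sup>2\<close> on \<open>\<pi>\<close> with \<open>A\<close> affine and equality at \<open>x\<^sub>0\<close>. On the complexification of
  \<open>\<pi>\<close>, the pluriharmonic function \<open>A (Re z) - \<epsilon>/2 (|Re z - x\<^sub>0|\<^sup>2 - |Im z|\<^sup>2)\<close> exceeds \<open>\<psi>\<close> by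
  \<open>\<epsilon>/2 |z - x\<^sub>0|\<^sup>2\<close>, so it violates \<open>q\<close>-plurisubharmonicity after subtracting a constant.

  If \<open>q\<close>-plurisubharmonicity fails on \<open>z\<^sub>0 + L\<close>, then near \<open>z\<^sub>0\<close> one has
  \<open>\<psi> (z\<^sub>0 + w) \<le> \<psi> z\<^sub>0 + A w + D w w / 2 - \<epsilon> |w|\<^sup>2\<close> for \<open>w \<in> L\<close>, with \<open>A\<close> linear and \<open>D\<close> the Hessian of a
  pluriharmonic function. Since \<open>\<psi>\<close> is constant in imaginary directions, \<open>D\<close> is positive definite on
  \<open>L \<inter> i \<real>\<^sup>n\<close>. Multiplication by \<open>i\<close> flips the sign of \<open>D\<close>, so \<open>D \<le> 0\<close> on some real subspace \<open>W\<close> of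
  \<open>L\<close> of real dimension \<open>q + 1\<close>. Hence \<open>Re\<close> is injective on \<open>W\<close>, and on \<open>Re z\<^sub>0 + Re W\<close> the function
  \<open>\<psi>\<close> lies below an affine function minus \<open>\<epsilon> |x - Re z\<^sub>0|\<^sup>2\<close>, against real \<open>q\<close>-convexity.
\<close>

subsection \<open>Upper semicontinuity\<close>

text \<open>Otherwise every \<open>x\<close> in \<open>K\<close> has a strictly better
  \<open>w x\<close>, and \<open>F\<close> stays below \<open>F (w x)\<close> near \<open>x\<close>.
  A finite subcover leaves finitely many candidates \<open>w c\<close>; the best of them lies in one
  of the covering sets and is therefore beaten by another candidate.\<close>

lemma usc_on_attains_max:
  fixes F :: "'a::topological_space \<Rightarrow> ereal"
  assumes "compact K" "K \<noteq> {}" and usc: "usc_on K F"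
  shows "\<exists>x\<in>K. \<forall>y\<in>K. F y \<le> F x"
proof (rule ccontr)
  assume "\<not> ?thesis"
  then have "\<forall>x\<in>K. \<exists>y\<in>K. F x < F y"
    by (auto simp: not_le)
  then obtain w where w: "\<And>x. x \<in> K \<Longrightarrow> w x \<in> K" "\<And>x. x \<in> K \<Longrightarrow> F x < F (w x)"
    by metis
  have "\<exists>T. open T \<and> x \<in> T \<and> (\<forall>y\<in>T \<inter> K. F y < F (w x))" if "x \<in> K" for x
  proof -
    have "\<forall>\<^sub>F y in at x within K. F y < F (w x)"
      using usc w that unfolding usc_on_def by blast
    then show ?thesis
      using w(2)[OF that] unfolding eventually_at_topological by (metis IntE)
  qed
  then obtain T where T: "\<And>x. x \<in> K \<Longrightarrow> open (T x)" "\<And>x. x \<in> K \<Longrightarrow> x \<in> T x"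
    "\<And>x y. x \<in> K \<Longrightarrow> y \<in> T x \<Longrightarrow> y \<in> K \<Longrightarrow> F y < F (w x)"
    by (metis IntI)
  obtain C where C: "C \<subseteq> K" "finite C" "K \<subseteq> (\<Union>c\<in>C. T c)"
  proof (rule compactE_image[OF \<open>compact K\<close>, of K T])
    show "K \<subseteq> (\<Union>c\<in>K. T c)"
      using T(2) by auto
  qed (use T(1) in auto)
  have "C \<noteq> {}"
    using C \<open>K \<noteq> {}\<close> by auto
  then have "Max ((\<lambda>c. F (w c)) ` C) \<in> (\<lambda>c. F (w c)) ` C"
    using C(2) by (intro Max_in) auto
  then obtain m where m: "m \<in> C" "F (w m) = Max ((\<lambda>c. F (w c)) ` C)"
    by auto
  then have "w m \<in> K"
    using w C by blast
  then obtain c where "c \<in> C" "w m \<in> T c"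
    using C by blast
  then have "F (w m) < F (w c)"
    using T(3) C \<open>w m \<in> K\<close> by blast
  moreover have "F (w c) \<le> F (w m)"
    unfolding m(2) using \<open>c \<in> C\<close> C(2) by (intro Max_ge) auto
  ultimately show False
    by simp
qed

lemma usc_on_subset:
  assumes "usc_on S u" "T \<subseteq> S"
  shows "usc_on T u"
  unfolding usc_on_def
proof (intro conjI ballI allI impI)
  fix x assume x: "x \<in> T"
  then show "u x < \<infinity>"
    using assms unfolding usc_on_def by blast
  fix c assume "u x < c"
  then have "\<forall>\<^sub>F y in at x within S. u y < c"
    using assms x unfolding usc_on_def by blast
  moreover have "at x within T \<le> at x within S"
    by (rule at_le) (fact assms(2))
  ultimately show "\<forall>\<^sub>F y in at x within T. u y < c"
    by (rule filter_leD[rotated])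
qed

lemma usc_on_compose:
  assumes u: "usc_on S u" and f: "continuous_on T f" "f ` T \<subseteq> S"
  shows "usc_on T (\<lambda>x. u (f x))"
  unfolding usc_on_def
proof (intro conjI ballI allI impI)
  fix x assume x: "x \<in> T"
  then have fx: "f x \<in> S"
    using f by blast
  then show "u (f x) < \<infinity>"
    using u unfolding usc_on_def by blast
  fix c assume c: "u (f x) < c"
  then have "\<forall>\<^sub>F y in at (f x) within S. u y < c"
    using u fx unfolding usc_on_def by blast
  then obtain A where A: "open A" "f x \<in> A" "\<And>y. y \<in> A \<Longrightarrow> y \<in> S \<Longrightarrow> u y < c"
    using c unfolding eventually_at_topological by metis
  have "\<forall>\<^sub>F y in at x within T. f y \<in> A"
    using f(1) x A(1,2) unfolding continuous_on_def by (blast intro: topological_tendstoD)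
  moreover have "\<forall>\<^sub>F y in at x within T. y \<in> T"
    by (simp add: eventually_at_topological) blast
  ultimately show "\<forall>\<^sub>F y in at x within T. u (f y) < c"
    by eventually_elim (use A f in blast)
qed

lemma usc_on_add_continuous:
  assumes u: "usc_on S u" and k: "continuous_on S k"
  shows "usc_on S (\<lambda>x. u x + ereal (k x))"
  unfolding usc_on_def
proof (intro conjI ballI allI impI)
  fix x assume x: "x \<in> S"
  then have ux: "u x < \<infinity>"
    using u unfolding usc_on_def by blast
  then show "u x + ereal (k x) < \<infinity>"
    by simp
  fix c assume c: "u x + ereal (k x) < c"
  then have "u x < c - ereal (k x)"
    by (simp add: ereal_less_minus)
  \<comment> \<open>A real \<open>d\<close> strictly in between separates the two conditions:
    semicontinuity gives \<open>u y < d\<close>, continuity gives \<open>d + k y < c\<close>, and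
    \<open>u x = -\<infinity>\<close> requires no special case.\<close>
  then obtain d where d: "u x < ereal d" "ereal d < c - ereal (k x)"
    using ereal_dense2 by blast
  have "\<forall>\<^sub>F y in at x within S. u y < ereal d"
    using u x d(1) unfolding usc_on_def by blast
  moreover have "\<forall>\<^sub>F y in at x within S. ereal d + ereal (k y) < c"
  proof -
    have tends: "((\<lambda>y. ereal (d + k y)) \<longlongrightarrow> ereal (d + k x)) (at x within S)"
      using k x by (auto simp: continuous_on_def intro!: tendsto_intros)
    have "ereal (d + k x) < c"
      using d(2) by (cases c) auto
    from order_tendstoD(2)[OF tends this] show ?thesis
      by simp
  qed
  ultimately show "\<forall>\<^sub>F y in at x within S. u y + ereal (k y) < c"
  proof eventually_elim
    case (elim y)
    then show ?case
      by (cases "u y"; cases c) auto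
  qed
qed

text \<open>
  The penalty \<open>\<epsilon> |x - a|\<^sup>2\<close> added to \<open>f - g\<close> is too small to move the maximum to the
  sphere; expanding it around the maximum point \<open>x\<^sub>0\<close> leaves a linear term and
  \<open>- \<epsilon> |x - x\<^sub>0|\<^sup>2\<close>.
\<close>
lemma strict_touching_point:
  fixes a :: "'a::euclidean_space" and f :: "'a \<Rightarrow> ereal"
  assumes S: "closed S" and usc: "usc_on (cball a r) f" and g: "continuous_on (cball a r) g"
    and bd: "\<And>x. x \<in> sphere a r \<Longrightarrow> x \<in> S \<Longrightarrow> f x \<le> ereal (g x)"
    and x1: "x1 \<in> cball a r" "x1 \<in> S" "\<not> f x1 \<le> ereal (g x1)"
  obtains x0 c \<epsilon> where "x0 \<in> ball a r" "x0 \<in> S" "0 < \<epsilon>" "f x0 = ereal c"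
    "\<And>x. x \<in> cball a r \<Longrightarrow> x \<in> S \<Longrightarrow>
      f x \<le> ereal (c + (g x - g x0) - 2 * \<epsilon> * ((x - x0) \<bullet> (x0 - a)) - \<epsilon> * (norm (x - x0))\<^sup>2)"
proof -
  let ?K = "cball a r \<inter> S"
  have K: "compact ?K" "?K \<noteq> {}"
    using S x1 by (auto intro: compact_Int_closed)
  have "f x1 < \<infinity>"
    using usc x1 unfolding usc_on_def by blast
  then obtain c1 where c1: "f x1 = ereal c1" "g x1 < c1"
    using x1(3) by (cases "f x1") auto
  \<comment> \<open>On the sphere the penalty is \<open>\<epsilon> r^2\<close>; the
    \<open>+ 1\<close> keeps it strictly below the gap \<open>c1 - g x1\<close> by which
    \<open>f\<close> exceeds \<open>g\<close> at \<open>x1\<close>.\<close>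
  define \<epsilon> where "\<epsilon> = (c1 - g x1) / (r\<^sup>2 + 1)"
  have r2: "0 < r\<^sup>2 + 1"
    by (simp add: add_nonneg_pos)
  have \<epsilon>: "0 < \<epsilon>" "\<epsilon> * r\<^sup>2 < c1 - g x1"
  proof -
    show "0 < \<epsilon>"
      using c1 r2 by (simp add: \<epsilon>_def)
    moreover have "\<epsilon> * (r\<^sup>2 + 1) = c1 - g x1"
      using r2 by (simp add: \<epsilon>_def)
    ultimately show "\<epsilon> * r\<^sup>2 < c1 - g x1"
      by (simp add: algebra_simps)
  qed
  define k where "k x = \<epsilon> * (norm (x - a))\<^sup>2 - g x" for x
  have "continuous_on (cball a r) k"
    unfolding k_def by (intro continuous_intros g)
  then have "usc_on ?K (\<lambda>x. f x + ereal (k x))"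
    using usc_on_add_continuous[OF usc] usc_on_subset by blast
  then obtain x0 where x0: "x0 \<in> ?K" "\<And>x. x \<in> ?K \<Longrightarrow> f x + ereal (k x) \<le> f x0 + ereal (k x0)"
    using usc_on_attains_max[OF K] by blast
  have ge: "ereal (c1 + k x1) \<le> f x0 + ereal (k x0)"
    using x0(2)[of x1] x1 c1 by simp
  have "f x0 < \<infinity>"
    using usc x0 unfolding usc_on_def by blast
  then obtain c where c: "f x0 = ereal c"
    using ge by (cases "f x0") auto
  have big: "\<epsilon> * r\<^sup>2 < c + k x0"
  proof -
    have "0 \<le> \<epsilon> * (norm (x1 - a))\<^sup>2"
      using \<epsilon> by simp
    then show ?thesis
      using ge \<epsilon>(2) unfolding c k_def[of x1] by simp
  qed
  \<comment> \<open>On the sphere \<open>f x0 \<le> g x0\<close>, so the maximal value would be at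
    most \<open>\<epsilon> r^2\<close>, against \<open>big\<close>.\<close>
  have "x0 \<notin> sphere a r"
  proof
    assume x0s: "x0 \<in> sphere a r"
    then have "c \<le> g x0"
      using bd[of x0] x0(1) c by simp
    moreover have "norm (x0 - a) = r"
      using x0s by (simp add: dist_norm norm_minus_commute)
    ultimately show False
      using big by (simp add: k_def)
  qed
  then have "x0 \<in> ball a r"
    using x0(1) by (simp add: less_le)
  moreover have "f x \<le> ereal (c + (g x - g x0) - 2 * \<epsilon> * ((x - x0) \<bullet> (x0 - a)) - \<epsilon> * (norm (x - x0))\<^sup>2)"
    if "x \<in> cball a r" "x \<in> S" for x
  proof -
    have "f x + ereal (k x) \<le> ereal (c + k x0)"
      using x0(2)[of x] that c by simp
    then have le: "f x \<le> ereal (c + k x0 - k x)"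
      by (cases "f x") auto
    have expand: "(norm (x - a))\<^sup>2 = (norm (x - x0))\<^sup>2 + 2 * ((x - x0) \<bullet> (x0 - a)) + (norm (x0 - a))\<^sup>2"
      by (simp add: power2_norm_eq_inner inner_diff_left inner_diff_right inner_commute)
    have "k x0 - k x = (g x - g x0) - \<epsilon> * ((norm (x - a))\<^sup>2 - (norm (x0 - a))\<^sup>2)"
      by (simp add: k_def algebra_simps)
    then have diff: "k x0 - k x = (g x - g x0) - 2 * \<epsilon> * ((x - x0) \<bullet> (x0 - a)) - \<epsilon> * (norm (x - x0))\<^sup>2"
      unfolding expand by (simp add: algebra_simps)
    have "c + k x0 - k x
      = c + (g x - g x0) - 2 * \<epsilon> * ((x - x0) \<bullet> (x0 - a)) - \<epsilon> * (norm (x - x0))\<^sup>2"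
      using diff by linarith
    with le show ?thesis
      by (simp only:)
  qed
  ultimately show ?thesis
    using that x0(1) \<epsilon>(1) c by blast
qed

subsection \<open>Pluriharmonic functions\<close>

text \<open>By symmetry the two terms of the product rule merge into
  \<open>2 * B (z - z0) w\<close>. The derivatives are explicit so that the Laplacian along a
  complex line can be read off.\<close>

lemma C2_derivs_on_quadratic:
  fixes A :: "'a::euclidean_space \<Rightarrow> real"
  assumes A: "linear A" and B: "bilinear B" and sym: "\<And>v w. B v w = B w v"
  shows "C2_derivs_on UNIV (\<lambda>z. c + A (z - z0) + B (z - z0) (z - z0))
    (\<lambda>z. Blinfun (\<lambda>w. A w + 2 * B (z - z0) w)) (\<lambda>z. Blinfun (\<lambda>v. Blinfun (\<lambda>w. 2 * B v w)))"
    (is "C2_derivs_on _ ?f ?f' ?f''")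
proof -
  have bB: "bounded_bilinear B" and bA: "bounded_linear A"
    using A B bilinear_conv_bounded_bilinear linear_conv_bounded_linear by blast+
  have B_add: "B (x + y) z = B x z + B y z" "B (k *\<^sub>R x) z = k * B x z" for x y z k
    using B by (simp_all add: bilinear_ladd bilinear_lmul)
  have lB: "bounded_linear (B v)" for v
    using bB by (rule bounded_bilinear.bounded_linear_right)
  define H where "H v = Blinfun (\<lambda>w. 2 * B v w)" for v
  have "bounded_linear (\<lambda>w. 2 * B v w)" for v
    by (intro bounded_linear_const_mult lB)
  then have H: "blinfun_apply (H v) w = 2 * B v w" for v w
    by (simp add: H_def bounded_linear_Blinfun_apply)
  have "linear H"
    by (rule linearI) (auto intro!: blinfun_eqI
        simp: H blinfun.add_left blinfun.scaleR_left B_add distrib_left)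
  then have bH: "bounded_linear H"
    by (simp add: linear_conv_bounded_linear)
  have f': "?f' z = Blinfun A + H (z - z0)" for z
  proof -
    have "bounded_linear (\<lambda>w. A w + 2 * B (z - z0) w)"
      by (intro bounded_linear_add bA bounded_linear_const_mult lB)
    then show ?thesis
      by (intro blinfun_eqI) (simp add: blinfun.add_left H bounded_linear_Blinfun_apply bA)
  qed
  have "(?f has_derivative blinfun_apply (?f' z)) (at z)" for z
  proof -
    have "((\<lambda>z. z - z0) has_derivative (\<lambda>w. w)) (at z)"
      by (auto intro!: derivative_eq_intros)
    then have "(?f has_derivative (\<lambda>w. A w + (B (z - z0) w + B w (z - z0)))) (at z)"
      by (auto intro!: derivative_eq_intros bounded_bilinear.FDERIV[OF bB]
          bounded_linear.has_derivative[OF bA])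
    moreover have "blinfun_apply (?f' z) = (\<lambda>w. A w + (B (z - z0) w + B w (z - z0)))"
      unfolding f' using sym by (auto simp: blinfun.add_left H bounded_linear_Blinfun_apply bA)
    ultimately show ?thesis by simp
  qed
  moreover have "(?f' has_derivative blinfun_apply (?f'' z)) (at z)" for z
  proof -
    have "((\<lambda>z. Blinfun A + H (z - z0)) has_derivative (\<lambda>w. 0 + H (w - 0))) (at z)"
      by (intro has_derivative_add has_derivative_const bounded_linear.has_derivative[OF bH]
          has_derivative_diff has_derivative_ident)
    then show ?thesis
      unfolding f' H_def[symmetric] by (simp add: bounded_linear_Blinfun_apply bH)
  qed
  ultimately show ?thesis
    unfolding C2_derivs_on_def by simp
qed

lemma linear_vector_smult_left: "linear (\<lambda>\<zeta>::complex. \<zeta> *s (b :: complex^'n))"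
  by (rule linearI) (simp_all add: vec_eq_iff algebra_simps)

lemma linear_vector_smult_right: "linear (\<lambda>b :: complex^'n. \<zeta> *s b)"
  by (rule linearI) (simp_all add: vec_eq_iff algebra_simps)

lemma bilinear_self_add:
  assumes "bilinear B"
  shows "B (x + y) (x + y) = B x x + B x y + B y x + B y y"
  using assms by (simp add: bilinear_ladd bilinear_radd)

text \<open>On the complex line through \<open>a\<close> in direction \<open>b\<close> the function
  is again quadratic, with Laplacian \<open>2 B b b + 2 B (\<i> b) (\<i> b)\<close>, which vanishes
  by \<open>skew\<close>.\<close>

lemma pluriharmonic_on_quadratic:
  fixes A :: "complex^'n \<Rightarrow> real"
  assumes A: "linear A" and B: "bilinear B" and sym: "\<And>v w. B v w = B w v"
    and skew: "\<And>v. B (\<i> *s v) (\<i> *s v) = - B v v"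
  shows "pluriharmonic_on UNIV (\<lambda>z. c + A (z - z0) + B (z - z0) (z - z0))"
  unfolding pluriharmonic_on_def
proof (intro conjI allI)
  show "\<exists>h' h''. C2_derivs_on UNIV (\<lambda>z. c + A (z - z0) + B (z - z0) (z - z0)) h' h''"
    using C2_derivs_on_quadratic[OF A B sym] by blast
next
  fix a b :: "complex^'n"
  \<comment> \<open>Expanding around \<open>a\<close>, the two equal cross terms
    \<open>B (a - z0) (\<zeta> b)\<close> join the linear part.\<close>
  define A' where "A' \<zeta> = A (\<zeta> *s b) + 2 * B (a - z0) (\<zeta> *s b)" for \<zeta>
  define B' where "B' \<zeta> \<eta> = B (\<zeta> *s b) (\<eta> *s b)" for \<zeta> \<eta>
  define c' where "c' = c + A (a - z0) + B (a - z0) (a - z0)"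
  have lin: "linear (\<lambda>\<zeta>. \<phi> (\<zeta> *s b))" if "linear \<phi>" for \<phi> :: "complex^'n \<Rightarrow> real"
    using linear_compose[OF linear_vector_smult_left that] by (simp add: o_def)
  have linB: "linear (B v)" "linear (\<lambda>w. B w v)" for v
    using B unfolding bilinear_def by blast+
  have A': "linear A'"
    unfolding A'_def
    using linear_compose_add[OF lin[OF A] linear_compose_scale_right[OF lin[OF linB(1)], of 2]]
    by simp
  have B': "bilinear B'"
    unfolding B'_def bilinear_def using lin linB by blast
  have sym': "B' \<zeta> \<eta> = B' \<eta> \<zeta>" for \<zeta> \<eta>
    unfolding B'_def by (rule sym)
  have eq: "(\<lambda>\<zeta>. c + A (a + \<zeta> *s b - z0) + B (a + \<zeta> *s b - z0) (a + \<zeta> *s b - z0))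
    = (\<lambda>\<zeta>. c' + A' (\<zeta> - 0) + B' (\<zeta> - 0) (\<zeta> - 0))"
  proof
    fix \<zeta>
    have *: "a + \<zeta> *s b - z0 = (a - z0) + \<zeta> *s b"
      by simp
    show "c + A (a + \<zeta> *s b - z0) + B (a + \<zeta> *s b - z0) (a + \<zeta> *s b - z0)
      = c' + A' (\<zeta> - 0) + B' (\<zeta> - 0) (\<zeta> - 0)"
      unfolding * bilinear_self_add[OF B] linear_add[OF A]
      by (simp add: A'_def B'_def c'_def sym[of "\<zeta> *s b" "a - z0"])
  qed
  define H where "H \<zeta> = Blinfun (\<lambda>\<eta>. 2 * B' \<zeta> \<eta>)" for \<zeta>
  have "bounded_linear (\<lambda>\<eta>. 2 * B' \<zeta> \<eta>)" for \<zeta>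
    using B' unfolding bilinear_def linear_conv_bounded_linear
    by (intro bounded_linear_const_mult) blast
  then have H: "blinfun_apply (H \<zeta>) \<eta> = 2 * B' \<zeta> \<eta>" for \<zeta> \<eta>
    by (simp add: H_def bounded_linear_Blinfun_apply)
  have "linear H"
    by (rule linearI) (auto intro!: blinfun_eqI simp: H blinfun.add_left blinfun.scaleR_left
        bilinear_ladd[OF B'] bilinear_lmul[OF B'] distrib_left)
  then have app: "blinfun_apply (blinfun_apply (Blinfun H) v) w = 2 * B' v w" for v w
    by (simp add: linear_conv_bounded_linear bounded_linear_Blinfun_apply H)
  have "B' \<i> \<i> = - B' 1 1"
    unfolding B'_def using skew by simp
  then show "harmonic_on {\<zeta>. a + \<zeta> *s b \<in> UNIV}
      (\<lambda>\<zeta>. c + A (a + \<zeta> *s b - z0) + B (a + \<zeta> *s b - z0) (a + \<zeta> *s b - z0))"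
    unfolding eq harmonic_on_def
    using C2_derivs_on_quadratic[OF A' B' sym', of c' 0, folded H_def] app by fastforce
qed

text \<open>A single mean value theorem on the segment suffices: the derivative of the second-order
  remainder is the first-order error of \<open>h'\<close> at \<open>z0\<close>, applied to
  \<open>w\<close>, hence at most \<open>\<eta> |w|^2\<close>.\<close>

lemma C2_taylor_upper_bound:
  fixes h :: "'a::real_normed_vector \<Rightarrow> real"
  assumes C2: "C2_derivs_on U h h' h''" and z0: "z0 \<in> U" and \<eta>: "0 < \<eta>"
  obtains \<delta> where "0 < \<delta>"
    "\<And>w. norm w < \<delta> \<Longrightarrow>
      h (z0 + w) \<le> h z0 + h' z0 w + h'' z0 w w / 2 + \<eta> * (norm w)\<^sup>2"
proof -
  have U: "open U" and d1: "\<And>x. x \<in> U \<Longrightarrow> (h has_derivative h' x) (at x)"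
    and d2: "(h' has_derivative h'' z0) (at z0)"
    using C2 z0 unfolding C2_derivs_on_def by blast+
  obtain d where d: "0 < d" "ball z0 d \<subseteq> U"
    using U z0 open_contains_ball by blast
  obtain e where e: "0 < e"
    "\<And>y. norm (y - z0) < e \<Longrightarrow> norm (h' y - h' z0 - h'' z0 (y - z0)) \<le> \<eta> * norm (y - z0)"
    using d2 \<eta> unfolding has_derivative_at_alt by blast
  have "h (z0 + w) \<le> h z0 + h' z0 w + h'' z0 w w / 2 + \<eta> * (norm w)\<^sup>2" if w: "norm w < min d e" for w
  proof -
    define g where "g t = h (z0 + t *\<^sub>R w) - t * h' z0 w - t\<^sup>2 / 2 * h'' z0 w w" for t
    define g' where "g' t = h' (z0 + t *\<^sub>R w) w - h' z0 w - t * h'' z0 w w" for t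
    have tw: "norm (t *\<^sub>R w) \<le> norm w" if "0 \<le> t" "t \<le> 1" for t
      using that by (simp add: mult_left_le_one_le)
    have "DERIV g t :> g' t" if t: "0 \<le> t" "t \<le> 1" for t
    proof -
      have "z0 + t *\<^sub>R w \<in> U"
        using d(2) tw[OF t] w by (auto simp: dist_norm)
      then have hd: "(h has_derivative h' (z0 + t *\<^sub>R w)) (at (z0 + t *\<^sub>R w))"
        by (rule d1)
      have "((\<lambda>t. z0 + t *\<^sub>R w) has_derivative (\<lambda>s. s *\<^sub>R w)) (at t)"
        by (auto intro!: derivative_eq_intros)
      from has_derivative_compose[OF this hd]
      have "((\<lambda>t. h (z0 + t *\<^sub>R w)) has_derivative (\<lambda>s. s * h' (z0 + t *\<^sub>R w) w)) (at t)"
        by (simp add: blinfun.scaleR_right)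
      then have "DERIV (\<lambda>t. h (z0 + t *\<^sub>R w)) t :> h' (z0 + t *\<^sub>R w) w"
        by (rule has_derivative_imp_has_field_derivative) (simp add: mult.commute)
      then show ?thesis
        unfolding g_def g'_def by (auto intro!: derivative_eq_intros)
    qed
    from MVT2[OF zero_less_one this]
    obtain t where t: "0 < t" "t < 1" "g 1 - g 0 = g' t"
      by auto
    have "g' t = (h' (z0 + t *\<^sub>R w) - h' z0 - h'' z0 (t *\<^sub>R w)) w"
      by (simp add: g'_def blinfun.diff_left blinfun.scaleR_right blinfun.scaleR_left)
    also have "\<dots> \<le> norm (h' (z0 + t *\<^sub>R w) - h' z0 - h'' z0 (t *\<^sub>R w)) * norm w"
      using norm_blinfun[of "h' (z0 + t *\<^sub>R w) - h' z0 - h'' z0 (t *\<^sub>R w)" w] by simp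
    also have "\<dots> \<le> (\<eta> * norm (t *\<^sub>R w)) * norm w"
      using e(2)[of "z0 + t *\<^sub>R w"] tw[of t] t w by (intro mult_right_mono) auto
    also have "\<dots> \<le> (\<eta> * norm w) * norm w"
      using tw[of t] t \<eta> by (intro mult_right_mono mult_left_mono) auto
    finally show ?thesis
      using t(3) by (simp add: g_def power2_eq_square algebra_simps)
  qed
  then show ?thesis
    using that[of "min d e"] d(1) e(1) by simp
qed

text \<open>Harmonicity on a complex line only provides some derivatives \<open>k'\<close>,
  \<open>k''\<close> of the restriction. Uniqueness of derivatives and the chain rule identify them
  with those of \<open>h\<close>, so the Laplacian at \<open>0\<close> is the sum of
  \<open>h''\<close> on \<open>b\<close> and on \<open>\<i> b\<close>.\<close>

lemma pluriharmonic_second_derivative_skew: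
  fixes h :: "complex^'n \<Rightarrow> real"
  assumes ph: "pluriharmonic_on U h" and C2: "C2_derivs_on U h h' h''" and z0: "z0 \<in> U"
  shows "h'' z0 (\<i> *s b) (\<i> *s b) = - h'' z0 b b"
proof -
  define O' where "O' = {\<zeta>. z0 + \<zeta> *s b \<in> U}"
  have "harmonic_on O' (\<lambda>\<zeta>. h (z0 + \<zeta> *s b))"
    using ph unfolding pluriharmonic_on_def O'_def by blast
  then obtain k' k'' where k: "C2_derivs_on O' (\<lambda>\<zeta>. h (z0 + \<zeta> *s b)) k' k''"
    and lap: "\<And>\<zeta>. \<zeta> \<in> O' \<Longrightarrow> k'' \<zeta> 1 1 + k'' \<zeta> \<i> \<i> = 0"
    unfolding harmonic_on_def by blast
  have O': "open O'" "0 \<in> O'"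
    using k z0 by (auto simp: C2_derivs_on_def O'_def)
  have line: "((\<lambda>\<zeta>. z0 + \<zeta> *s b) has_derivative (\<lambda>\<eta>. \<eta> *s b)) (at \<zeta>)" for \<zeta>
  proof -
    have "bounded_linear (\<lambda>\<zeta>. \<zeta> *s b)"
      using linear_vector_smult_left linear_conv_bounded_linear by blast
    from has_derivative_add[OF has_derivative_const bounded_linear_imp_has_derivative[OF this]]
    show ?thesis by simp
  qed
  have k': "k' \<zeta> v = h' (z0 + \<zeta> *s b) (v *s b)" if "\<zeta> \<in> O'" for \<zeta> v
  proof -
    have "(h has_derivative h' (z0 + \<zeta> *s b)) (at (z0 + \<zeta> *s b))"
      using C2 that by (auto simp: C2_derivs_on_def O'_def)
    from has_derivative_compose[OF line this]
    have "((\<lambda>\<zeta>. h (z0 + \<zeta> *s b)) has_derivative (\<lambda>v. h' (z0 + \<zeta> *s b) (v *s b))) (at \<zeta>)" .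
    moreover have "((\<lambda>\<zeta>. h (z0 + \<zeta> *s b)) has_derivative k' \<zeta>) (at \<zeta>)"
      using k that by (auto simp: C2_derivs_on_def)
    ultimately show ?thesis
      by (metis has_derivative_unique)
  qed
  have k'': "k'' 0 v v = h'' z0 (v *s b) (v *s b)" for v
  proof -
    have "(k' has_derivative k'' 0) (at 0)"
      using k O' by (auto simp: C2_derivs_on_def)
    then have "((\<lambda>\<zeta>. k' \<zeta> v) has_derivative (\<lambda>\<eta>. k'' 0 \<eta> v)) (at 0)"
      by (auto intro!: derivative_eq_intros)
    then have 1: "((\<lambda>\<zeta>. h' (z0 + \<zeta> *s b) (v *s b)) has_derivative (\<lambda>\<eta>. k'' 0 \<eta> v)) (at 0)"
      by (rule has_derivative_transform_within_open[OF _ O']) (rule k')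
    have "(h' has_derivative h'' z0) (at (z0 + 0 *s b))"
      using C2 z0 by (auto simp: C2_derivs_on_def)
    from has_derivative_compose[OF line this]
    have "((\<lambda>\<zeta>. h' (z0 + \<zeta> *s b)) has_derivative (\<lambda>\<eta>. h'' z0 (\<eta> *s b))) (at 0)" .
    then have "((\<lambda>\<zeta>. h' (z0 + \<zeta> *s b) (v *s b)) has_derivative
        (\<lambda>\<eta>. h'' z0 (\<eta> *s b) (v *s b))) (at 0)"
      by (auto intro!: derivative_eq_intros)
    from has_derivative_unique[OF 1 this] show ?thesis
      by metis
  qed
  show ?thesis
    using lap[OF O'(2)] k''[of 1] k''[of \<i>] by simp
qed

subsection \<open>Real and complex linear algebra\<close>

text \<open>
  If \<open>P\<close> is a maximal subspace of \<open>L\<close> on which \<open>B\<close> is positive definite, then \<open>B\<close> is negative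
  definite on \<open>J P\<close>, so \<open>dim P \<le> dim L / 2\<close>, and \<open>B \<le> 0\<close> on the \<open>B\<close>-orthogonal complement
  of \<open>P\<close> in \<open>L\<close>.
\<close>
lemma nonpositive_half_dimensional_subspace:
  fixes B :: "'a::euclidean_space \<Rightarrow> 'a \<Rightarrow> real"
  assumes B: "bilinear B" and sym: "\<And>v w. B v w = B w v"
    and J: "linear J" and skew: "\<And>v. B (J v) (J v) = - B v v"
    and L: "subspace L" "J ` L \<subseteq> L" and m: "2 * m \<le> dim L"
  obtains W where "subspace W" "W \<subseteq> L" "dim W = m" "\<And>w. w \<in> W \<Longrightarrow> B w w \<le> 0"
proof -
  have linB: "linear (B v)" "linear (\<lambda>w. B w v)" for v
    using B unfolding bilinear_def by blast+
  have B0: "B 0 v = 0" "B v 0 = 0" for v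
    using linB linear_0 by blast+
  define \<P> where "\<P> P \<longleftrightarrow> subspace P \<and> P \<subseteq> L \<and> (\<forall>p\<in>P. p \<noteq> 0 \<longrightarrow> 0 < B p p)" for P
  have "\<P> {0}"
    using L(1) by (simp add: \<P>_def subspace_0)
  moreover have "\<forall>P. \<P> P \<longrightarrow> dim P < Suc DIM('a)"
    by (auto simp: less_Suc_eq_le dim_subset_UNIV)
  ultimately obtain P where P: "\<P> P" and maxP: "\<And>P'. \<P> P' \<Longrightarrow> dim P' \<le> dim P"
    using ex_has_greatest_nat[of \<P> "{0}" dim "Suc DIM('a)"] by blast
  have Psub: "subspace P" "P \<subseteq> L" and pos: "\<And>p. p \<in> P \<Longrightarrow> p \<noteq> 0 \<Longrightarrow> 0 < B p p"
    using P by (auto simp: \<P>_def)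
  have dimP: "2 * dim P \<le> dim L"
  proof -
    have inj: "inj_on J P"
    proof (subst linear_inj_on_iff_eq_0[OF J Psub(1)], intro ballI impI)
      fix p assume "p \<in> P" "J p = 0"
      then show "p = 0"
        using skew[of p] pos[of p] B0 by fastforce
    qed
    then have "dim (J ` P) = dim P"
      using dim_image_eq[OF J] Psub(1) by (simp add: span_eq_iff[THEN iffD2])
    moreover have "subspace (J ` P)"
      using J Psub(1) by (rule linear_subspace_image)
    moreover have "P \<inter> J ` P = {0}"
    proof -
      have "p = 0" if "p \<in> P" "p' \<in> P" "p = J p'" for p p'
        using pos[of p] pos[of p'] skew[of p'] that linear_0[OF J] by fastforce
      then show ?thesis
        using subspace_0[OF Psub(1)] linear_0[OF J] by force
    qed
    moreover have "{x + y |x y. x \<in> P \<and> y \<in> J ` P} \<subseteq> L"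
      using Psub L subspace_add by blast
    ultimately show ?thesis
      using dim_sums_Int[OF Psub(1), of "J ` P"] dim_subset[of "{x + y |x y. x \<in> P \<and> y \<in> J ` P}" L]
      by simp
  qed
  define T where "T p = (\<Sum>i\<in>Basis. B i p *\<^sub>R i)" for p
  have T: "T p \<bullet> v = B v p" for p v
  proof -
    have "B v p = (\<Sum>i\<in>Basis. (v \<bullet> i) *\<^sub>R B i p)"
      using linear_sum[OF linB(2), of "\<lambda>i. (v \<bullet> i) *\<^sub>R i" Basis]
      by (simp add: euclidean_representation linear_scale[OF linB(2)])
    then show ?thesis
      by (simp add: T_def inner_sum_left mult.commute inner_commute[of v])
  qed
  have "linear T"
    by (rule linearI) (simp_all add: T_def linear_add[OF linB(1)] linear_scale[OF linB(1)]
        scaleR_add_left sum.distrib scaleR_sum_right)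
  define Q where "Q = {v. \<forall>p\<in>P. B v p = 0}"
  have Q: "subspace Q"
    unfolding Q_def subspace_def by (auto simp: B0 linear_add[OF linB(2)] linear_scale[OF linB(2)])
  have "Q = {y \<in> UNIV. \<forall>x \<in> T ` P. orthogonal x y}"
    by (auto simp: Q_def orthogonal_def T)
  then have "dim Q + dim (T ` P) = DIM('a)"
    using dim_subspace_orthogonal_to_vectors[of "T ` P" UNIV] linear_subspace_image[OF \<open>linear T\<close> Psub(1)]
    by simp
  moreover have "dim (T ` P) \<le> dim P"
    using \<open>linear T\<close> by (rule dim_image_le)
  moreover have "dim L + dim Q \<le> dim (L \<inter> Q) + DIM('a)"
    using dim_sums_Int[OF L(1) Q] dim_subset_UNIV[of "{x + y |x y. x \<in> L \<and> y \<in> Q}"] by simp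
  ultimately have "m \<le> dim (L \<inter> Q)"
    using dimP m by linarith
  then obtain W where W: "subspace W" "W \<subseteq> span (L \<inter> Q)" "dim W = m"
    using choose_subspace_of_subspace by blast
  then have WLQ: "W \<subseteq> L \<inter> Q"
    using subspace_Int[of "{L, Q}" id] L(1) Q by (metis span_eq_iff subspace_inter)
  have "B v v \<le> 0" if "v \<in> L" "v \<in> Q" for v
  proof (rule ccontr)
    assume "\<not> B v v \<le> 0"
    then have v: "0 < B v v" by simp
    have vp: "B v p = 0" "B p v = 0" if "p \<in> P" for p
      using \<open>v \<in> Q\<close> that sym by (auto simp: Q_def)
    then have "v \<notin> P"
      using v by force
    \<comment> \<open>The cross terms vanish because \<open>v\<close> is \<open>B\<close>-orthogonal
      to \<open>P\<close>, so adjoining \<open>v\<close> preserves positive definiteness and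
      contradicts the maximal dimension of \<open>P\<close>.\<close>
    have "\<P> (span (insert v P))"
      unfolding \<P>_def
    proof (intro conjI ballI impI)
      show "span (insert v P) \<subseteq> L"
        using \<open>v \<in> L\<close> Psub(2) L(1) by (intro span_minimal) auto
    next
      fix x assume x: "x \<in> span (insert v P)" "x \<noteq> 0"
      then obtain k where "x - k *\<^sub>R v \<in> P"
        using span_breakdown_eq[of x v P] Psub(1) by (auto simp: span_eq_iff[THEN iffD2])
      then obtain p where p: "p \<in> P" "x = k *\<^sub>R v + p"
        by (metis add_diff_cancel_left' diff_add_cancel add.commute)
      have eq: "B x x = k * k * B v v + B p p"
        unfolding p(2) bilinear_self_add[OF B]
        by (simp add: bilinear_lmul[OF B] bilinear_rmul[OF B] vp[OF p(1)])
      show "0 < B x x"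
      proof (cases "p = 0")
        case True
        then show ?thesis
          using eq x(2) p(2) v by (auto simp: B0 zero_less_mult_iff)
      next
        case False
        then show ?thesis
          using eq pos[OF p(1)] v by (simp add: add_nonneg_pos)
      qed
    qed simp
    from maxP[OF this] show False
      using \<open>v \<notin> P\<close> Psub(1) by (simp add: dim_insert span_eq_iff[THEN iffD2])
  qed
  then show ?thesis
    using that W WLQ by blast
qed

section \<open>Real and imaginary parts of complex vectors; tubes\<close>

definition Im_vec :: "complex^'n \<Rightarrow> real^'n" where
  "Im_vec z = (\<chi> i. Im (z $ i))"

lemma linear_Re_vec: "linear Re_vec"
  by (rule linearI) (simp_all add: Re_vec_def vec_eq_iff)

lemma linear_Im_vec: "linear Im_vec"
  by (rule linearI) (simp_all add: Im_vec_def vec_eq_iff)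

lemma linear_cvec: "linear cvec"
  by (rule linearI) (simp_all add: cvec_def vec_eq_iff complex_eq_iff)

lemma Re_vec_cvec [simp]: "Re_vec (cvec x) = x"
  by (simp add: Re_vec_def cvec_def vec_eq_iff)

lemma Im_vec_cvec [simp]: "Im_vec (cvec x) = 0"
  by (simp add: Im_vec_def cvec_def vec_eq_iff)

lemma Re_vec_smult: "Re_vec (c *s z) = Re c *\<^sub>R Re_vec z - Im c *\<^sub>R Im_vec z"
  by (simp add: Re_vec_def Im_vec_def vec_eq_iff)

lemma Im_vec_smult: "Im_vec (c *s z) = Re c *\<^sub>R Im_vec z + Im c *\<^sub>R Re_vec z"
  by (simp add: Re_vec_def Im_vec_def vec_eq_iff)

lemma norm_Re_vec_Im_vec: "(norm z)\<^sup>2 = (norm (Re_vec z))\<^sup>2 + (norm (Im_vec z))\<^sup>2"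
  by (simp add: power2_norm_eq_inner inner_vec_def Re_vec_def Im_vec_def inner_complex_def
      sum.distrib)

lemma norm_Re_vec_le: "norm (Re_vec z) \<le> norm z"
  using norm_Re_vec_Im_vec[of z] by (simp add: norm_le_square power2_norm_eq_inner norm_le)

lemma mem_tube_iff: "z \<in> tube \<omega> \<longleftrightarrow> Re_vec z \<in> \<omega>"
proof
  assume "Re_vec z \<in> \<omega>"
  moreover have "z = cvec (Re_vec z) + \<i> *s cvec (Im_vec z)"
    by (simp add: cvec_def Re_vec_def Im_vec_def vec_eq_iff complex_eq_iff)
  ultimately show "z \<in> tube \<omega>"
    unfolding tube_def by blast
next
  assume "z \<in> tube \<omega>"
  then show "Re_vec z \<in> \<omega>"
    unfolding tube_def by (auto simp: Re_vec_def cvec_def)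
qed

section \<open>Real and complex dimensions of subspaces\<close>

lemma complex_subspace_imp_subspace:
  fixes L :: "(complex^'n) set"
  assumes "vec.subspace L"
  shows "subspace L"
proof (rule subspaceI)
  fix c :: real and x assume "x \<in> L"
  then have "complex_of_real c *s x \<in> L"
    by (rule vec.subspace_scale[OF assms])
  moreover have "complex_of_real c *s x = c *\<^sub>R x"
    by (simp add: vec_eq_iff complex_eq_iff)
  ultimately show "c *\<^sub>R x \<in> L" by simp
qed (use assms vec.subspace_0 vec.subspace_add in blast)+

text \<open>\<open>L\<close> is the complexification of \<open>V\<close>, the complex span of a real
  basis. Real parts of a complex span lie in the real span, which yields both the inclusion and, by
  induction on the basis, complex independence.\<close>

lemma complex_subspace_of_real_subspace:
  fixes V :: "(real^'n) set"
  assumes V: "subspace V"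
  obtains L where "vec.subspace L" "vec.dim L = dim V" "Re_vec ` L \<subseteq> V"
proof -
  obtain B where B: "B \<subseteq> V" "independent B" "V \<subseteq> span B" "card B = dim V"
    using basis_exists by blast
  have Re_span: "Re_vec ` vec.span (cvec ` C) \<subseteq> span C" for C :: "(real^'n) set"
  proof -
    \<comment> \<open>This is the sum of \<open>span C\<close> and \<open>\<i>\<close> times
      \<open>span C\<close>; requiring both parts to lie in \<open>span C\<close> makes it closed
      under complex scalars.\<close>
    let ?S = "{z. Re_vec z \<in> span C \<and> Im_vec z \<in> span C}"
    have "vec.subspace ?S"
      unfolding vec.subspace_def
      by (auto simp: linear_0[OF linear_Re_vec] linear_0[OF linear_Im_vec] linear_add[OF linear_Re_vec]
          linear_add[OF linear_Im_vec] Re_vec_smult Im_vec_smult span_zero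
          intro!: span_add span_diff span_scale)
    moreover have "cvec ` C \<subseteq> ?S"
      by (auto simp: span_base span_zero)
    ultimately have "vec.span (cvec ` C) \<subseteq> ?S"
      by (intro vec.span_minimal)
    then show ?thesis by auto
  qed
  have "vec.independent (cvec ` C)" if "finite C" "independent C" for C :: "(real^'n) set"
    using that
  proof (induction C)
    case empty
    then show ?case by (simp add: vec.independent_empty)
  next
    case (insert b C)
    then have b: "b \<notin> span C" "independent C"
      by (auto simp: independent_insert)
    then have "cvec b \<notin> vec.span (cvec ` C)"
      using Re_span[of C] by (metis Re_vec_cvec image_subset_iff)
    then show ?case
      using insert b(2) vec.independent_insertI[of "cvec b" "cvec ` C"] by simp
  qed
  then have "vec.independent (cvec ` B)"
    using B(2) finiteI_independent by blast
  moreover have "inj cvec"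
    by (metis Re_vec_cvec injI)
  ultimately have "vec.dim (vec.span (cvec ` B)) = dim V"
    using B(4) by (metis vec.dim_span_eq_card_independent card_image inj_on_subset subset_UNIV)
  moreover have "Re_vec ` vec.span (cvec ` B) \<subseteq> V"
    using Re_span[of B] B(1) V by (meson span_minimal subset_trans)
  ultimately show ?thesis
    using that vec.subspace_span by blast
qed

text \<open>Each new complex basis vector \<open>b\<close> contributes two real dimensions, namely
  those of \<open>b\<close> and \<open>\<i> b\<close>.\<close>

lemma dim_complex_subspace_ge:
  fixes L :: "(complex^'n) set"
  assumes L: "vec.subspace L"
  shows "2 * vec.dim L \<le> dim L"
proof -
  obtain B where B: "B \<subseteq> L" "vec.independent B" "card B = vec.dim L"
    using vec.basis_exists[of L] by metis
  have "2 * card C \<le> dim (vec.span C)" if "finite C" "vec.independent C" for C :: "(complex^'n) set"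
    using that
  proof (induction C)
    case (insert b C)
    let ?M = "vec.span C"
    have b: "b \<notin> ?M" "vec.independent C"
      using insert by (auto simp: vec.independent_insert)
    have M: "subspace ?M"
      by (intro complex_subspace_imp_subspace vec.subspace_span)
    \<comment> \<open>A relation \<open>\<i> b - k b\<close> in the complex span \<open>?M\<close>
      with \<open>k\<close> real would put \<open>b\<close> itself in \<open>?M\<close>, since
      \<open>\<i> - k\<close> is invertible.\<close>
    have ib: "\<i> *s b \<notin> span (insert b ?M)"
    proof
      assume "\<i> *s b \<in> span (insert b ?M)"
      then obtain k where "\<i> *s b - k *\<^sub>R b \<in> ?M"
        using span_breakdown_eq[of "\<i> *s b" b ?M] M by (auto simp: span_eq_iff[THEN iffD2])
      moreover have "\<i> *s b - k *\<^sub>R b = (\<i> - of_real k) *s b"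
        by (simp add: vec_eq_iff complex_eq_iff algebra_simps)
      ultimately have "inverse (\<i> - of_real k) *s ((\<i> - of_real k) *s b) \<in> ?M"
        by (metis vec.span_scale)
      moreover have "\<i> - of_real k \<noteq> 0"
        by (simp add: complex_eq_iff)
      ultimately show False
        using b(1) by (metis left_inverse vector_smult_assoc vector_smult_lid)
    qed
    have "insert (\<i> *s b) (insert b ?M) \<subseteq> vec.span (insert b C)"
      by (auto intro: vec.span_scale vec.span_base vec.span_mono[THEN subsetD, of C])
    then have "dim (insert (\<i> *s b) (insert b ?M)) \<le> dim (vec.span (insert b C))"
      by (rule dim_subset)
    moreover have "dim (insert (\<i> *s b) (insert b ?M)) = dim ?M + 2"
      using ib b(1) M by (simp add: dim_insert span_eq_iff[THEN iffD2])
    ultimately show ?case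
      using insert b(2) by simp
  qed simp
  then have "2 * card B \<le> dim (vec.span B)"
    using B(2) vec.finiteI_independent by blast
  also have "\<dots> \<le> dim L"
    using B(1) L by (intro dim_subset vec.span_minimal)
  finally show ?thesis
    using B(3) by simp
qed

text \<open>The increment \<open>k v = l (p + v) - l p\<close> is linear on the direction space
  \<open>V\<close>; extending its values on a basis of \<open>V\<close> gives a globally defined
  linear map, to which continuity and linearity rules apply.\<close>

lemma affine_fun_on_imp_linear:
  fixes \<pi> :: "'a::real_vector set"
  assumes \<pi>: "affine \<pi>" "p \<in> \<pi>" and l: "affine_fun_on \<pi> l"
  obtains g where "linear g" "\<And>x. x \<in> \<pi> \<Longrightarrow> l x = l p + g (x - p)"
proof -
  define V where "V = (\<lambda>x. x - p) ` \<pi>"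
  have V: "subspace V"
    unfolding V_def using \<pi> by (rule affine_diffs_subspace_subtract)
  have memV: "v \<in> V \<longleftrightarrow> p + v \<in> \<pi>" for v
    unfolding V_def by (auto simp: image_iff algebra_simps intro!: bexI[of _ "p + v"])
  define k where "k v = l (p + v) - l p" for v
  have k_scale: "k (t *\<^sub>R v) = t * k v" if "v \<in> V" for t v
  proof -
    have "l ((1 - t) *\<^sub>R p + t *\<^sub>R (p + v)) = (1 - t) * l p + t * l (p + v)"
      using l \<pi>(2) that memV unfolding affine_fun_on_def by blast
    moreover have "(1 - t) *\<^sub>R p + t *\<^sub>R (p + v) = p + t *\<^sub>R v"
      by (simp add: algebra_simps)
    ultimately show ?thesis
      by (simp add: k_def algebra_simps)
  qed
  have k_add: "k (v + w) = k v + k w" if "v \<in> V" "w \<in> V" for v w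
  proof -
    \<comment> \<open>Additivity comes from the affine condition at a midpoint:
      \<open>p + (v + w)\<close> is halfway between \<open>p + 2 v\<close> and
      \<open>p + 2 w\<close>.\<close>
    have "p + 2 *\<^sub>R v \<in> \<pi>" "p + 2 *\<^sub>R w \<in> \<pi>"
      using that V subspace_scale memV by blast+
    then have "l ((1 - 1/2) *\<^sub>R (p + 2 *\<^sub>R v) + (1/2) *\<^sub>R (p + 2 *\<^sub>R w))
      = (1 - 1/2) * l (p + 2 *\<^sub>R v) + (1/2) * l (p + 2 *\<^sub>R w)"
      using l unfolding affine_fun_on_def by blast
    moreover have "(1 - 1/2) *\<^sub>R (p + 2 *\<^sub>R v) + (1/2) *\<^sub>R (p + 2 *\<^sub>R w) = p + (v + w)"
      by (simp add: scaleR_add_right flip: scaleR_add_left)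
    ultimately have "k (v + w) = (1/2) * k (2 *\<^sub>R v) + (1/2) * k (2 *\<^sub>R w)"
      by (simp add: k_def field_simps)
    then show ?thesis
      using k_scale that by simp
  qed
  obtain B where B: "B \<subseteq> V" "independent B" "V \<subseteq> span B"
    using maximal_independent_subset by blast
  obtain g where g: "linear g" "\<And>b. b \<in> B \<Longrightarrow> g b = k b"
    using linear_independent_extend[OF B(2)] by metis
  have "subspace {v \<in> V. k v = g v}"
    using V k_add k_scale k_scale[of 0 0]
    by (auto simp: subspace_def linear_0[OF g(1)] linear_add[OF g(1)] linear_scale[OF g(1)])
  then have "span B \<subseteq> {v \<in> V. k v = g v}"
    using B(1) g(2) by (intro span_minimal) auto
  then have "k v = g v" if "v \<in> V" for v
    using that B(3) by blast
  then have "l x = l p + g (x - p)" if "x \<in> \<pi>" for x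
    using that memV[of "x - p"] by (force simp: k_def)
  with g(1) that show ?thesis by blast
qed

lemma cball_dist_subset:
  fixes a :: "'a::metric_space"
  shows "cball x (r - dist a x) \<subseteq> cball a r"
proof
  fix y assume "y \<in> cball x (r - dist a x)"
  then show "y \<in> cball a r"
    using dist_triangle[of a y x] by simp
qed

subsection \<open>The two implications\<close>

lemma q_psh_imp_real_q_convex:
  fixes \<psi> :: "complex^'n \<Rightarrow> ereal"
  assumes inv: "\<And>z. z \<in> tube \<omega> \<Longrightarrow> \<psi> z = \<psi> (cvec (Re_vec z))"
    and psh: "q_psh_on q (tube \<omega>) \<psi>"
  shows "real_q_convex_on q \<omega> (\<lambda>x. \<psi> (cvec x))"
proof -
  have usc: "usc_on \<omega> (\<lambda>x. \<psi> (cvec x))"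
  proof (rule usc_on_compose[where f = cvec])
    show "usc_on (tube \<omega>) \<psi>"
      using psh by (simp add: q_psh_on_def)
    show "continuous_on \<omega> cvec"
      using linear_cvec linear_continuous_on linear_conv_bounded_linear by blast
    show "cvec ` \<omega> \<subseteq> tube \<omega>"
      by (auto simp: mem_tube_iff)
  qed
  have "\<forall>x\<in>cball a r \<inter> \<pi>. \<psi> (cvec x) \<le> ereal (l x)"
    if q: "q < CARD('n)" and \<pi>: "affine \<pi>" "aff_dim \<pi> = int (q + 1)"
      and r: "cball a r \<subseteq> \<omega>" and l: "affine_fun_on \<pi> l"
      and bd: "\<forall>x\<in>sphere a r \<inter> \<pi>. \<psi> (cvec x) \<le> ereal (l x)" for \<pi> a r l
  proof (rule ccontr)
    assume "\<not> ?thesis"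
    then obtain x1 where x1: "x1 \<in> cball a r" "x1 \<in> \<pi>" "\<not> \<psi> (cvec x1) \<le> ereal (l x1)"
      by blast
    obtain g where g: "linear g" "\<And>x. x \<in> \<pi> \<Longrightarrow> l x = l x1 + g (x - x1)"
      using affine_fun_on_imp_linear[OF \<pi>(1) x1(2) l] by blast
    have cont: "continuous_on (cball a r) (\<lambda>x. l x1 + g (x - x1))"
      using g(1) by (intro continuous_intros linear_continuous_on_compose[of _ _ g]) auto
    obtain x0 c \<epsilon> where x0: "x0 \<in> ball a r" "x0 \<in> \<pi>" "0 < \<epsilon>" "\<psi> (cvec x0) = ereal c"
      and touch: "\<And>x. x \<in> cball a r \<Longrightarrow> x \<in> \<pi> \<Longrightarrow>
        \<psi> (cvec x) \<le> ereal (c + ((l x1 + g (x - x1)) - (l x1 + g (x0 - x1)))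
          - 2 * \<epsilon> * ((x - x0) \<bullet> (x0 - a)) - \<epsilon> * (norm (x - x0))\<^sup>2)"
    proof (rule strict_touching_point[OF affine_closed[OF \<pi>(1)] usc_on_subset[OF usc r] cont])
      show "\<not> \<psi> (cvec x1) \<le> ereal (l x1 + g (x1 - x1))"
        using x1(3) by (simp add: linear_0[OF g(1)])
      show "\<psi> (cvec x) \<le> ereal (l x1 + g (x - x1))" if "x \<in> sphere a r" "x \<in> \<pi>" for x
        using bd that g(2)[OF that(2)] by (metis IntI)
    qed (use x1(1,2) in auto)
    \<comment> \<open>\<open>A\<close> collects the slope of \<open>l\<close> and the linear term
      left by recentring the penalty from \<open>a\<close> to \<open>x0\<close>.\<close>
    define A where "A v = g v - 2 * \<epsilon> * (v \<bullet> (x0 - a))" for v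
    have A: "linear A"
      by (rule linearI)
        (simp_all add: A_def linear_add[OF g(1)] linear_scale[OF g(1)] inner_add_left algebra_simps)
    have touch': "\<psi> (cvec x) \<le> ereal (c + A (x - x0) - \<epsilon> * (norm (x - x0))\<^sup>2)"
      if "x \<in> cball a r" "x \<in> \<pi>" for x
    proof -
      have "g (x - x1) - g (x0 - x1) = g (x - x0)"
        by (simp flip: linear_diff[OF g(1)])
      then show ?thesis
        using touch[OF that] by (simp add: A_def algebra_simps)
    qed
    define V where "V = (\<lambda>x. x - x0) ` \<pi>"
    have V: "subspace V"
      unfolding V_def using \<pi>(1) x0(2) by (rule affine_diffs_subspace_subtract)
    have dimV: "dim V = q + 1"
      using aff_dim_eq_dim_subtract[of x0 \<pi>] hull_inc[OF x0(2)] \<pi>(2) by (simp add: V_def)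
    \<comment> \<open>\<open>P = z0 + L\<close> will be the complexification of
      \<open>\<pi>\<close>: complex dimension \<open>q + 1\<close>, with real parts in
      \<open>\<pi>\<close>.\<close>
    obtain L where L: "vec.subspace L" "vec.dim L = dim V" "Re_vec ` L \<subseteq> V"
      using complex_subspace_of_real_subspace[OF V] .
    define z0 where "z0 = cvec x0"
    define P where "P = (+) z0 ` L"
    define \<rho> where "\<rho> = r - dist a x0"
    have \<rho>: "0 < \<rho>" "cball x0 \<rho> \<subseteq> cball a r"
      using x0(1) cball_dist_subset by (auto simp: \<rho>_def)
    define B where "B v w = - (\<epsilon> / 2) * (Re_vec v \<bullet> Re_vec w - Im_vec v \<bullet> Im_vec w)"
      for v w :: "complex^'n"
    \<comment> \<open>The constant is lowered by \<open>\<epsilon> / 2\<close> times the squared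
      radius. On the sphere that square is \<open>|Re w|^2 + |Im w|^2\<close>, so the imaginary
      terms cancel and \<open>h\<close> equals the touching bound, while at the centre
      \<open>h z0 < c\<close>.\<close>
    define h where "h z = (c - \<epsilon> / 2 * \<rho>\<^sup>2) + A (Re_vec (z - z0)) + B (z - z0) (z - z0)" for z
    have "pluriharmonic_on UNIV h"
      unfolding h_def
    proof (rule pluriharmonic_on_quadratic[where A = "\<lambda>v. A (Re_vec v)" and B = B])
      show "linear (\<lambda>v. A (Re_vec v))"
        using linear_compose[OF linear_Re_vec A] by (simp add: o_def)
      show "bilinear B"
        unfolding bilinear_def B_def
        by (auto intro!: linearI simp: linear_add[OF linear_Re_vec] linear_add[OF linear_Im_vec]
            linear_scale[OF linear_Re_vec] linear_scale[OF linear_Im_vec]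
            inner_add_left inner_add_right field_simps)
      show "B v w = B w v" for v w
        by (simp add: B_def inner_commute)
      show "B (\<i> *s v) (\<i> *s v) = - B v v" for v
        by (simp add: B_def Re_vec_smult Im_vec_smult algebra_simps)
    qed
    moreover have "complex_affine_subspace (q + 1) P"
      unfolding complex_affine_subspace_def P_def using L dimV by metis
    moreover have tube: "cball z0 \<rho> \<subseteq> tube \<omega>"
      and Re_cball: "\<And>z. z \<in> cball z0 \<rho> \<Longrightarrow> Re_vec z \<in> cball x0 \<rho>"
    proof -
      show Re: "Re_vec z \<in> cball x0 \<rho>" if "z \<in> cball z0 \<rho>" for z
        using that norm_Re_vec_le[of "z0 - z"]
        by (simp add: dist_norm linear_diff[OF linear_Re_vec] z0_def)
      then show "cball z0 \<rho> \<subseteq> tube \<omega>"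
        using \<rho>(2) r by (fastforce simp: mem_tube_iff)
    qed
    moreover have "\<psi> z \<le> ereal (h z)" if z: "z \<in> sphere z0 \<rho>" "z \<in> P" for z
    proof -
      have zc: "z \<in> cball z0 \<rho>"
        using z(1) by simp
      obtain w where w: "w \<in> L" "z = z0 + w"
        using z(2) P_def by blast
      have Re_z: "Re_vec z - x0 = Re_vec w"
        by (simp add: w(2) z0_def linear_add[OF linear_Re_vec])
      have "Re_vec z \<in> \<pi>"
        using L(3) w(1) Re_z unfolding V_def by (smt (verit) diff_add_cancel image_iff image_subset_iff)
      then have "\<psi> (cvec (Re_vec z)) \<le> ereal (c + A (Re_vec w) - \<epsilon> * (norm (Re_vec w))\<^sup>2)"
        using touch'[of "Re_vec z"] Re_cball[OF zc] \<rho>(2) Re_z by auto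
      moreover have "h z = c + A (Re_vec w) - \<epsilon> * (norm (Re_vec w))\<^sup>2"
      proof -
        have "\<rho>\<^sup>2 = (norm (Re_vec w))\<^sup>2 + (norm (Im_vec w))\<^sup>2"
          using z(1) w(2) by (simp add: dist_norm flip: norm_Re_vec_Im_vec)
        then show ?thesis
          by (simp add: h_def B_def w(2) power2_norm_eq_inner algebra_simps)
      qed
      ultimately show ?thesis
        using inv[of z] tube zc by auto
    qed
    ultimately have "\<forall>z\<in>cball z0 \<rho> \<inter> P. \<psi> z \<le> ereal (h z)"
      using psh q \<rho>(1) unfolding q_psh_on_def by (metis IntD1 IntD2 subset_UNIV)
    moreover have "z0 \<in> cball z0 \<rho> \<inter> P"
      using \<rho>(1) vec.subspace_0[OF L(1)] by (force simp: P_def)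
    moreover have "h z0 = c - \<epsilon> / 2 * \<rho>\<^sup>2"
      by (simp add: h_def B_def linear_0[OF A] linear_0[OF linear_Re_vec] linear_0[OF linear_Im_vec])
    ultimately have "c \<le> c - \<epsilon> / 2 * \<rho>\<^sup>2"
      using x0(4) by (metis ereal_less_eq(3) z0_def)
    then show False
      using \<rho>(1) x0(3) by (simp add: mult_le_0_iff)
  qed
  then show ?thesis
    using usc unfolding real_q_convex_on_def by blast
qed

lemma real_q_convex_imp_q_psh:
  fixes \<psi> :: "complex^'n \<Rightarrow> ereal"
  assumes \<omega>: "open \<omega>" and usc: "usc_on (tube \<omega>) \<psi>"
    and inv: "\<And>z. z \<in> tube \<omega> \<Longrightarrow> \<psi> z = \<psi> (cvec (Re_vec z))"
    and convex: "real_q_convex_on q \<omega> (\<lambda>x. \<psi> (cvec x))"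
  shows "q_psh_on q (tube \<omega>) \<psi>"
proof -
  have "\<forall>z\<in>cball a r \<inter> P. \<psi> z \<le> ereal (h z)"
    if q: "q < CARD('n)" and P: "complex_affine_subspace (q + 1) P"
      and r: "cball a r \<subseteq> tube \<omega>" "cball a r \<subseteq> U" and h: "pluriharmonic_on U h"
      and bd: "\<forall>z\<in>sphere a r \<inter> P. \<psi> z \<le> ereal (h z)" for P a r U h
  proof (rule ccontr)
    assume "\<not> ?thesis"
    then obtain z1 where z1: "z1 \<in> cball a r" "z1 \<in> P" "\<not> \<psi> z1 \<le> ereal (h z1)"
      by blast
    obtain p L where L: "vec.subspace L" "vec.dim L = q + 1" and P_eq: "P = (+) p ` L"
      using P unfolding complex_affine_subspace_def by blast
    have Lsub: "subspace L"
      using L(1) by (rule complex_subspace_imp_subspace)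
    have "closed P"
      unfolding P_eq by (intro closed_translation closed_subspace Lsub)
    obtain h' h'' where C2: "C2_derivs_on U h h' h''"
      using h unfolding pluriharmonic_on_def by blast
    have "continuous_on (cball a r) h"
      using C2 r(2) unfolding C2_derivs_on_def
      by (intro continuous_at_imp_continuous_on) (meson has_derivative_continuous subsetD)
    then obtain z0 c \<epsilon> where z0: "z0 \<in> ball a r" "z0 \<in> P" "0 < \<epsilon>" "\<psi> z0 = ereal c"
      and touch: "\<And>z. z \<in> cball a r \<Longrightarrow> z \<in> P \<Longrightarrow>
        \<psi> z \<le> ereal (c + (h z - h z0) - 2 * \<epsilon> * ((z - z0) \<bullet> (z0 - a)) - \<epsilon> * (norm (z - z0))\<^sup>2)"
      using strict_touching_point[OF \<open>closed P\<close> usc_on_subset[OF usc r(1)], of h z1] z1 bd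
      by (metis IntI)
    have "z0 \<in> U"
      using z0(1) r(2) by auto
    \<comment> \<open>Half of the \<open>\<epsilon>\<close> from the penalty pays for the Taylor
      error; the other half survives in \<open>upper\<close>.\<close>
    obtain \<delta> where \<delta>: "0 < \<delta>" and taylor: "\<And>w. norm w < \<delta> \<Longrightarrow>
        h (z0 + w) \<le> h z0 + h' z0 w + h'' z0 w w / 2 + \<epsilon> / 2 * (norm w)\<^sup>2"
      using C2_taylor_upper_bound[OF C2 \<open>z0 \<in> U\<close>, of "\<epsilon> / 2"] z0(3) by auto
    define A where "A w = h' z0 w - 2 * \<epsilon> * (w \<bullet> (z0 - a))" for w
    define D where "D v w = h'' z0 v w" for v w
    have A: "linear A"
      by (rule linearI)
        (simp_all add: A_def blinfun.add_right blinfun.scaleR_right inner_add_left algebra_simps)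
    have D_add: "D (v + v') w = D v w + D v' w" "D v (w + w') = D v w + D v w'" for v v' w w'
      by (simp_all add: D_def blinfun.add_left blinfun.add_right)
    have D_scale: "D (t *\<^sub>R v) w = t * D v w" "D v (t *\<^sub>R w) = t * D v w" for v w t
      by (simp_all add: D_def blinfun.scaleR_left blinfun.scaleR_right)
    have D_skew: "D (\<i> *s v) (\<i> *s v) = - D v v" for v
      unfolding D_def by (rule pluriharmonic_second_derivative_skew[OF h C2 \<open>z0 \<in> U\<close>])
    define m where "m = min \<delta> (r - dist a z0)"
    have m: "0 < m"
      using \<delta> z0(1) by (simp add: m_def)
    have near: "z0 + w \<in> cball a r" if "norm w < m" for w
      using that by (intro subsetD[OF cball_dist_subset[of z0 r a]]) (simp add: m_def dist_norm)
    have z0w: "z0 + w \<in> P" if "w \<in> L" for w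
      using z0(2) that vec.subspace_add[OF L(1)] unfolding P_eq by (auto simp: add.assoc)
    have upper: "\<psi> (cvec (Re_vec z0 + Re_vec w)) \<le> ereal (c + A w + D w w / 2 - \<epsilon> / 2 * (norm w)\<^sup>2)"
      if w: "w \<in> L" "norm w < m" for w
    proof -
      have "\<psi> (z0 + w) \<le> ereal (c + (h (z0 + w) - h z0) - 2 * \<epsilon> * (w \<bullet> (z0 - a)) - \<epsilon> * (norm w)\<^sup>2)"
        using touch[OF near[OF w(2)] z0w[OF w(1)]] by simp
      also have "\<dots> \<le> ereal (c + A w + D w w / 2 - \<epsilon> / 2 * (norm w)\<^sup>2)"
        using taylor[of w] w(2) by (simp add: m_def A_def D_def)
      finally show ?thesis
        using inv[of "z0 + w"] near[OF w(2)] r(1) linear_add[OF linear_Re_vec, of z0 w] by auto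
    qed
    have x0: "Re_vec z0 \<in> \<omega>" "\<psi> (cvec (Re_vec z0)) = ereal c"
      using inv[of z0] z0 r(1) by (auto simp: mem_tube_iff subset_iff)

    text \<open>\<open>\<psi>\<close> is constant in imaginary directions: average the bound over \<open>w\<close> and \<open>- w\<close>.\<close>
    have D_pos: "0 < D w w" if w: "w \<in> L" "Re_vec w = 0" "w \<noteq> 0" for w
    proof -
      \<comment> \<open>Rescaling to norm \<open>m / 2\<close> brings both \<open>v\<close> and
        \<open>- v\<close> into the range of \<open>upper\<close>.\<close>
      define t where "t = m / (2 * norm w)"
      define v where "v = t *\<^sub>R w"
      have t: "0 < t" "norm v < m"
        using m w(3) by (simp_all add: t_def v_def)
      have "v \<in> L" "- v \<in> L" "Re_vec v = 0" "Re_vec (- v) = 0"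
        using w Lsub by (simp_all add: v_def subspace_scale subspace_neg
            linear_scale[OF linear_Re_vec] linear_neg[OF linear_Re_vec])
      moreover have "D (- v) (- v) = D v v" "A (- v) = - A v"
        using linear_neg[OF A] by (simp_all add: D_def blinfun.minus_left blinfun.minus_right)
      ultimately have "\<epsilon> * (norm v)\<^sup>2 \<le> D v v"
        using upper[of v] upper[of "- v"] t(2) x0(2) by simp
      moreover have "0 < \<epsilon> * (norm v)\<^sup>2"
        using z0(3) t(1) w(3) by (simp add: v_def)
      moreover have "D v v = t\<^sup>2 * D w w"
        by (simp add: v_def D_scale power2_eq_square)
      ultimately have "0 < t\<^sup>2 * D w w"
        by linarith
      then show ?thesis
        using t(1) by (simp add: zero_less_mult_iff)
    qed

    \<comment> \<open>The form \<open>D v w + D w v\<close> is symmetric by construction and equals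
      \<open>2 D w w\<close> on the diagonal, so its sign is that of \<open>D\<close>.\<close>
    obtain W where W: "subspace W" "W \<subseteq> L" "dim W = q + 1" and nonpos: "\<And>w. w \<in> W \<Longrightarrow> D w w + D w w \<le> 0"
    proof (rule nonpositive_half_dimensional_subspace[of "\<lambda>v w. D v w + D w v" "(*s) \<i>" L "q + 1"])
      show "bilinear (\<lambda>v w. D v w + D w v)"
        unfolding bilinear_def by (auto intro!: linearI simp: D_add D_scale algebra_simps)
      show "(*s) \<i> ` L \<subseteq> L"
        using vec.subspace_scale[OF L(1)] by auto
      show "2 * (q + 1) \<le> dim L"
        using dim_complex_subspace_ge[OF L(1)] L(2) by simp
    qed (use Lsub D_skew linear_vector_smult_right in auto)
    \<comment> \<open>A nonzero vector of \<open>W\<close> with zero real part would make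
      \<open>D\<close> positive by \<open>D_pos\<close> and nonpositive by
      \<open>nonpos\<close>.\<close>
    have inj: "inj_on Re_vec W"
    proof (subst linear_inj_on_iff_eq_0[OF linear_Re_vec W(1)], intro ballI impI)
      fix w assume "w \<in> W" "Re_vec w = 0"
      then show "w = 0"
        using D_pos[of w] nonpos[of w] W(2) by force
    qed
    then obtain k where k: "linear k" "\<And>w. w \<in> W \<Longrightarrow> k (Re_vec w) = w"
      using linear_exists_left_inverse_on[OF linear_Re_vec W(1)] by blast
    obtain K where K: "0 < K" "\<And>x. norm (k x) \<le> K * norm x"
      using linear_bounded_pos[OF k(1)] by blast
    obtain \<rho>1 where \<rho>1: "0 < \<rho>1" "cball (Re_vec z0) \<rho>1 \<subseteq> \<omega>"
      using \<omega> x0(1) open_contains_cball by blast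
    \<comment> \<open>A point at distance at most \<open>\<rho>\<close> from
      \<open>Re_vec z0\<close> lifts through \<open>k\<close> to a vector of norm at most
      \<open>K * \<rho>\<close>; the factor 2 keeps this strictly below \<open>m\<close>, as
      \<open>upper\<close> demands.\<close>
    define \<rho> where "\<rho> = min \<rho>1 (m / (2 * K))"
    have \<rho>: "0 < \<rho>" "cball (Re_vec z0) \<rho> \<subseteq> \<omega>" "K * \<rho> < m"
    proof -
      show "0 < \<rho>"
        using \<rho>1 m K by (simp add: \<rho>_def)
      show "cball (Re_vec z0) \<rho> \<subseteq> \<omega>"
        using \<rho>1(2) by (auto simp: \<rho>_def)
      have "K * \<rho> \<le> K * (m / (2 * K))"
        using K(1) by (intro mult_left_mono) (auto simp: \<rho>_def)
      then show "K * \<rho> < m"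
        using K(1) m by simp
    qed
    define \<pi> where "\<pi> = (+) (Re_vec z0) ` Re_vec ` W"
    \<comment> \<open>On the sphere \<open>|w| \<ge> |Re w| = \<rho>\<close> and
      \<open>D w w \<le> 0\<close>, so \<open>upper\<close> bounds the function by \<open>l\<close>;
      at the centre \<open>l\<close> is strictly below \<open>c\<close>.\<close>
    define l where "l x = c - \<epsilon> / 2 * \<rho>\<^sup>2 + A (k (x - Re_vec z0))" for x
    have VW: "subspace (Re_vec ` W)"
      using linear_Re_vec W(1) by (rule linear_subspace_image)
    have "affine \<pi>"
      unfolding \<pi>_def using VW affine_translation subspace_imp_affine by blast
    moreover have "aff_dim \<pi> = int (q + 1)"
    proof -
      have "dim (Re_vec ` W) = q + 1"
        using dim_image_eq[OF linear_Re_vec, of W] inj W by (simp add: span_eq_iff[THEN iffD2])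
      then show ?thesis
        using VW by (simp add: \<pi>_def aff_dim_translation_eq aff_dim_subspace)
    qed
    moreover have "affine_fun_on \<pi> l"
      unfolding affine_fun_on_def
    proof (intro ballI allI)
      fix x y t
      have "(1 - t) *\<^sub>R x + t *\<^sub>R y - Re_vec z0 = (1 - t) *\<^sub>R (x - Re_vec z0) + t *\<^sub>R (y - Re_vec z0)"
        by (simp add: algebra_simps)
      then have "A (k ((1 - t) *\<^sub>R x + t *\<^sub>R y - Re_vec z0))
        = (1 - t) * A (k (x - Re_vec z0)) + t * A (k (y - Re_vec z0))"
        by (simp add: linear_add[OF k(1)] linear_scale[OF k(1)] linear_add[OF A] linear_scale[OF A])
      then show "l ((1 - t) *\<^sub>R x + t *\<^sub>R y) = (1 - t) * l x + t * l y"
        unfolding l_def by (simp only:) (simp add: field_simps)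
    qed
    moreover have "\<psi> (cvec x) \<le> ereal (l x)" if x: "x \<in> sphere (Re_vec z0) \<rho>" "x \<in> \<pi>" for x
    proof -
      obtain w where w: "w \<in> W" "x = Re_vec z0 + Re_vec w"
        using x(2) \<pi>_def by blast
      have nw: "norm (Re_vec w) = \<rho>"
        using x(1) w(2) by (simp add: dist_norm)
      then have "norm w \<le> K * \<rho>"
        using K(2)[of "Re_vec w"] k(2)[OF w(1)] by simp
      then have "\<psi> (cvec x) \<le> ereal (c + A w + D w w / 2 - \<epsilon> / 2 * (norm w)\<^sup>2)"
        using upper[of w] w W(2) \<rho>(3) by auto
      moreover have "\<epsilon> / 2 * \<rho>\<^sup>2 \<le> \<epsilon> / 2 * (norm w)\<^sup>2"
        using norm_Re_vec_le[of w] nw z0(3) \<rho>(1) by (intro mult_left_mono power_mono) auto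
      moreover have "l x = c - \<epsilon> / 2 * \<rho>\<^sup>2 + A w"
        by (simp add: l_def w(2) k(2)[OF w(1)])
      ultimately show ?thesis
        using nonpos[OF w(1)] by (elim order_trans) simp
    qed
    ultimately have "\<forall>x\<in>cball (Re_vec z0) \<rho> \<inter> \<pi>. \<psi> (cvec x) \<le> ereal (l x)"
      using convex q \<rho>(1,2) unfolding real_q_convex_on_def by (metis IntD1 IntD2)
    moreover have "Re_vec z0 \<in> cball (Re_vec z0) \<rho> \<inter> \<pi>"
      using \<rho>(1) subspace_0[OF VW] by (force simp: \<pi>_def)
    moreover have "l (Re_vec z0) = c - \<epsilon> / 2 * \<rho>\<^sup>2"
      by (simp add: l_def linear_0[OF A] linear_0[OF k(1)])
    ultimately have "c \<le> c - \<epsilon> / 2 * \<rho>\<^sup>2"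
      using x0(2) by (metis ereal_less_eq(3))
    then show False
      using \<rho>(1) z0(3) by (simp add: mult_le_0_iff)
  qed
  then show ?thesis
    using usc unfolding q_psh_on_def by blast
qed

theorem mainTheorem1:
  fixes q :: nat
    and \<omega> :: "(real^'n) set"
    and \<Omega> :: "(complex^'n) set"
    and \<psi> :: "complex^'n \<Rightarrow> ereal"
  assumes "open \<omega>"
    and "\<Omega> = tube \<omega>"
    and "usc_on \<Omega> \<psi>"
    and "\<And>z. z \<in> \<Omega> \<Longrightarrow> \<psi> z = \<psi> (cvec (Re_vec z))"
  shows "q_psh_on q \<Omega> \<psi> \<longleftrightarrow> real_q_convex_on q \<omega> (\<lambda>x. \<psi> (cvec x))"
  using assms q_psh_imp_real_q_convex real_q_convex_imp_q_psh by blast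

end
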